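(* Let $n \ge 1$ and $\ell \ge 2$ be integers, and let $x^0=(x^0_1,\dots,x^0_n)\in\mathbb{Z}^n$ satisfy $x^0_1\le\dots\le x^0_n$, have at least one entry that is a multiple of $\ell$, and satisfy $\mathrm{range}(x^0)\le \ell$. Let $x^0\to x^1\to\dots\to x^j\to\dots$ be the GM-sequence starting at $x^0$. Then for every $j\ge 0$, $\mathrm{pivot}(x^j)-\mathrm{pivot}(x^{j+\ell})\equiv 1 \pmod n$; that is, the pivot of $x^{j+\ell}$ is one less than the pivot of $x^j$, with the cyclic convention $1-1=0=n$.
   Context: Notation: $[n]=\{1,\dots,n\}$. Entries of vectors are integers and may be negative; $0$ and negative multiples count as multiples of $\ell$. For a vector with $x_1\le\dots\le x_n$, $\mathrm{range}(x)=x_n-x_1$. Pivot: let $x=(x_1,\dots,x_n)$ be an integer vector with $x_1\le \dots\le x_n$ having at least one entry that is a multiple of $\ell$. Among the entries of $x$ that are multiples of $\ell$, take the minimal value; the pivot of $x$, $\mathrm{pivot}(x)\in[n]$, is the largest index $i$ such that $x_i$ equals this value. GM-move: the GM-move $x\to x'$ keeps the pivotal entry ($x'_i=x_i$ for $i=\mathrm{pivot}(x)$) and reduces each of the other $n-1$ entries by $1$ ($x'_k=x_k-1$ for $k\ne i$). The vector $x'$ again satisfies $x'_1\le\dots\le x'_n$ and has an entry that is a multiple of $\ell$. The GM-sequence starting at $x^0$ is the infinite sequence $x^0\to x^1\to x^2\to\dots$ of successive GM-moves. *)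

theory Defs
  imports "HOL-Number_Theory.Cong"
begin

text \<open>
  An integer vector \<open>(x\<^sub>1, \<dots>, x\<^sub>n)\<close> is a function \<open>x :: nat \<Rightarrow> int\<close> read on the
  index set \<open>{1..n}\<close> only; values of \<open>x\<close> elsewhere are irrelevant.
\<close>

definition nondecreasing :: "nat \<Rightarrow> (nat \<Rightarrow> int) \<Rightarrow> bool" where
  "nondecreasing n x \<longleftrightarrow> (\<forall>i\<in>{1..n}. \<forall>k\<in>{1..n}. i \<le> k \<longrightarrow> x i \<le> x k)"

text \<open>The range of a vector, meaningful for nondecreasing \<open>x\<close> and \<open>n \<ge> 1\<close>.\<close>

definition vec_range :: "nat \<Rightarrow> (nat \<Rightarrow> int) \<Rightarrow> int" where
  "vec_range n x = x n - x 1"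

definition has_multiple :: "nat \<Rightarrow> nat \<Rightarrow> (nat \<Rightarrow> int) \<Rightarrow> bool" where
  "has_multiple l n x \<longleftrightarrow> (\<exists>i\<in>{1..n}. int l dvd x i)"

definition min_multiple :: "nat \<Rightarrow> nat \<Rightarrow> (nat \<Rightarrow> int) \<Rightarrow> int" where
  "min_multiple l n x = Min {x i | i. i \<in> {1..n} \<and> int l dvd x i}"

text \<open>
  As \<open>Min\<close> and \<open>Max\<close> are unspecified on the empty set, \<open>min_multiple\<close> and \<open>pivot\<close>
  are meaningful only under \<open>has_multiple l n x\<close>, a property that GM-moves preserve
  since the pivotal entry is kept.
\<close>

definition pivot :: "nat \<Rightarrow> nat \<Rightarrow> (nat \<Rightarrow> int) \<Rightarrow> nat" where
  "pivot l n x = Max {i \<in> {1..n}. x i = min_multiple l n x}"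

definition GM_move :: "nat \<Rightarrow> nat \<Rightarrow> (nat \<Rightarrow> int) \<Rightarrow> (nat \<Rightarrow> int)" where
  "GM_move l n x = (\<lambda>k. if k \<in> {1..n} \<and> k \<noteq> pivot l n x then x k - 1 else x k)"

primrec GM_seq :: "nat \<Rightarrow> nat \<Rightarrow> (nat \<Rightarrow> int) \<Rightarrow> nat \<Rightarrow> (nat \<Rightarrow> int)" where
  "GM_seq l n x0 0 = x0"
| "GM_seq l n x0 (Suc j) = GM_move l n (GM_seq l n x0 j)"

end

theory Submission
  imports Defs
begin

text \<open>
  Let \<open>a\<close> be the pivot and \<open>p\<close> its value. During the next \<open>l\<close> moves the entry at \<open>a\<close> is kept by
  the first one, so it ends above \<open>p - l\<close>. The cyclically preceding entry ends at most at
  \<open>p - l\<close> (at most at \<open>p\<close>, if it is the last entry): it could only overtake this bound by being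
  the pivot when the bound is tight, but then divisibility by \<open>l\<close> forces this to happen at the
  very first move, where the pivot is \<open>a\<close>. The two bounds leave only one place for the new pivot.
\<close>

text \<open>The only place where \<open>Min\<close> and \<open>Max\<close> are unfolded: both sets
  are finite, and the second is nonempty because the minimum is attained.\<close>

lemma pivot_min_multiple:
  assumes "has_multiple l n x"
  shows "pivot l n x \<in> {1..n}"
    and "int l dvd x (pivot l n x)"
    and "\<And>k. k \<in> {1..n} \<Longrightarrow> int l dvd x k \<Longrightarrow> x (pivot l n x) \<le> x k"
    and "\<And>k. k \<in> {1..n} \<Longrightarrow> x k = x (pivot l n x) \<Longrightarrow> k \<le> pivot l n x"
proof -
  define M where "M = {x i | i. i \<in> {1..n} \<and> int l dvd x i}"
  have fin: "finite M"
    unfolding M_def by (rule finite_subset[of _ "x ` {1..n}"]) auto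
  have "M \<noteq> {}"
    using assms by (auto simp: M_def has_multiple_def)
  then have mem: "min_multiple l n x \<in> M"
    using Min_in[OF fin] by (simp add: min_multiple_def M_def)
  define P where "P = {i \<in> {1..n}. x i = min_multiple l n x}"
  have finP: "finite P" by (simp add: P_def)
  have "P \<noteq> {}"
    using mem by (auto simp: P_def M_def)
  then have piv: "pivot l n x \<in> P"
    using Max_in[OF finP] by (simp add: pivot_def P_def)
  then show "pivot l n x \<in> {1..n}" by (simp add: P_def)
  have val: "x (pivot l n x) = min_multiple l n x"
    using piv by (simp add: P_def)
  then show "int l dvd x (pivot l n x)"
    using mem by (auto simp: M_def)
  show "x (pivot l n x) \<le> x k" if "k \<in> {1..n}" "int l dvd x k" for k
  proof -
    have "x k \<in> M" using that by (auto simp: M_def)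
    then show ?thesis
      using Min_le[OF fin] val by (simp add: min_multiple_def M_def)
  qed
  show "k \<le> pivot l n x" if "k \<in> {1..n}" "x k = x (pivot l n x)" for k
  proof -
    have "k \<in> P" using that val by (simp add: P_def)
    then show ?thesis
      using Max_ge[OF finP] by (simp add: pivot_def P_def)
  qed
qed

text \<open>The hypotheses on the starting vector, bundled because GM-moves preserve them
  jointly.\<close>

definition narrow :: "nat \<Rightarrow> nat \<Rightarrow> (nat \<Rightarrow> int) \<Rightarrow> bool" where
  "narrow l n x \<longleftrightarrow> nondecreasing n x \<and> has_multiple l n x \<and> vec_range n x \<le> int l"

lemma narrow_mono:
  assumes "narrow l n x" "1 \<le> i" "i \<le> k" "k \<le> n"
  shows "x i \<le> x k"
  using assms by (auto simp: narrow_def nondecreasing_def)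

text \<open>Otherwise the range bound forces \<open>x 1\<close> to equal the pivotal value minus
  \<open>l\<close>, a smaller multiple of \<open>l\<close>.\<close>

lemma narrow_first_gt:
  assumes "narrow l n x" "l > 0"
  shows "x (pivot l n x) - int l < x 1"
proof (rule ccontr)
  let ?a = "pivot l n x"
  assume "\<not> ?thesis"
  then have le: "x 1 \<le> x ?a - int l" by simp
  have hm: "has_multiple l n x" and "x n - x 1 \<le> int l"
    using assms(1) by (auto simp: narrow_def vec_range_def)
  moreover have a: "?a \<in> {1..n}" by (rule pivot_min_multiple(1)[OF hm])
  moreover have "x ?a \<le> x n" using narrow_mono[OF assms(1)] a by simp
  ultimately have eq: "x 1 = x ?a - int l" using le by linarith
  then have "int l dvd x 1"
    using pivot_min_multiple(2)[OF hm] by simp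
  moreover have "1 \<in> {1..n}" using a by simp
  ultimately have "x ?a \<le> x 1" using pivot_min_multiple(3)[OF hm] by blast
  then show False using eq assms(2) by simp
qed

lemma narrow_GM_move:
  assumes "narrow l n x" "l > 0"
  shows "narrow l n (GM_move l n x)"
proof -
  let ?a = "pivot l n x" and ?y = "GM_move l n x"
  have hm: "has_multiple l n x" and r: "x n - x 1 \<le> int l"
    using assms(1) by (auto simp: narrow_def vec_range_def)
  note a = pivot_min_multiple[OF hm]
  have "nondecreasing n ?y"
    unfolding nondecreasing_def
  proof (intro ballI impI)
    fix i k assume ik: "i \<in> {1..n}" "k \<in> {1..n}" "i \<le> k"
    then have le: "x i \<le> x k" using narrow_mono[OF assms(1)] by simp
    \<comment> \<open>Order could only break where the pivotal entry stays and an equal later entry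
      drops; but the pivot is the last index with its value.\<close>
    moreover have "x i \<noteq> x k" if "i = ?a" "k \<noteq> ?a"
      using a(4)[of k] ik that by auto
    ultimately show "?y i \<le> ?y k"
      using ik by (auto simp: GM_move_def)
  qed
  moreover have "has_multiple l n ?y"
    unfolding has_multiple_def using a(1,2)
    by (intro bexI[of _ ?a]) (auto simp: GM_move_def)
  \<comment> \<open>The range grows only if the pivot is \<open>n\<close> and
    \<open>n \<noteq> 1\<close>; the strict bound of \<open>narrow_first_gt\<close> leaves room for
    this one unit.\<close>
  moreover have "?y n - ?y 1 \<le> int l"
    using narrow_first_gt[OF assms] r a(1) by (auto simp: GM_move_def)
  ultimately show ?thesis by (simp add: narrow_def vec_range_def)
qed

lemma narrow_GM_seq:
  assumes "narrow l n x" "l > 0"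
  shows "narrow l n (GM_seq l n x j)"
  using assms by (induction j) (auto intro: narrow_GM_move)

lemma GM_seq_add: "GM_seq l n x (j + m) = GM_seq l n (GM_seq l n x j) m"
  by (induction m) auto

lemma GM_seq_ge: "x k - int j \<le> GM_seq l n x j k"
proof (induction j)
  case (Suc j)
  then show ?case by (auto simp: GM_move_def)
qed simp

text \<open>\<open>q\<close> is \<open>p\<close> or \<open>p + l\<close> for the pivotal value \<open>p\<close>.\<close>

lemma GM_seq_le:
  assumes "narrow l n x" "l > 0"
    and k: "k \<in> {1..n}" "k \<noteq> pivot l n x"
    and q: "int l dvd q" "x k \<le> q"
    and "s \<le> l"
  shows "GM_seq l n x s k \<le> q - int s"
  using \<open>s \<le> l\<close>
proof (induction s)
  case 0
  then show ?case using q by simp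
next
  case (Suc s)
  let ?y = "GM_seq l n x s"
  have IH: "?y k \<le> q - int s" using Suc by simp
  have hm: "has_multiple l n ?y"
    using narrow_GM_seq[OF assms(1,2)] by (simp add: narrow_def)
  \<comment> \<open>The bound falls by one per move, so only a pivotal \<open>k\<close> meeting it
    exactly could break it. Then \<open>l\<close> divides \<open>s < l\<close>, hence
    \<open>s = 0\<close>, where the pivot is that of \<open>x\<close> and not
    \<open>k\<close>.\<close>
  have "?y k \<noteq> q - int s" if piv: "k = pivot l n ?y"
  proof
    assume "?y k = q - int s"
    then have "int l dvd q - int s" using pivot_min_multiple(2)[OF hm] piv by simp
    then have "int l dvd int s" using q(1) dvd_diff_right_iff by blast
    then have "s = 0" using Suc.prems by (auto dest: dvd_imp_le)
    then show False using piv k by simp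
  qed
  then show ?case using IH k by (auto simp: GM_move_def)
qed

lemma pivot_GM_seq_period:
  assumes x: "narrow l n x" and l: "l > 0"
  shows "pivot l n (GM_seq l n x l) = (if pivot l n x = 1 then n else pivot l n x - 1)"
proof -
  define a where "a = pivot l n x"
  define y where "y = GM_seq l n x l"
  define b where "b = pivot l n y"
  have y: "narrow l n y" unfolding y_def by (rule narrow_GM_seq[OF x l])
  have hmx: "has_multiple l n x" and hmy: "has_multiple l n y" and r: "x n - x 1 \<le> int l"
    using x y by (auto simp: narrow_def vec_range_def)
  note pa = pivot_min_multiple[OF hmx, folded a_def]
  note pb = pivot_min_multiple[OF hmy, folded b_def]
  \<comment> \<open>The first move costs entry \<open>a\<close> nothing, the other
    \<open>l - 1\<close> moves at most one each.\<close>
  have ya: "x a - int l < y a"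
  proof -
    have "GM_seq l n x 1 a = x a" by (simp add: GM_move_def a_def)
    moreover have "y = GM_seq l n (GM_seq l n x 1) (l - 1)"
      using l GM_seq_add[of l n x 1 "l - 1"] by (simp add: y_def)
    ultimately have "x a - int (l - 1) \<le> y a" using GM_seq_ge by metis
    then show ?thesis using l by (simp add: of_nat_diff)
  qed
  \<comment> \<open>Used to identify the pivotal value \<open>y b\<close>, a multiple of
    \<open>l\<close>, with a candidate \<open>w\<close>.\<close>
  have sandwich: "z = w"
    if "int l dvd z" "int l dvd w" "w - int l < z" "z < w + int l" for z w :: int
  proof -
    have "int l dvd z - w" using that by simp
    moreover have "\<bar>z - w\<bar> < int l" using that by linarith
    ultimately show ?thesis using dvd_imp_le_int[of "z - w" "int l"] by fastforce
  qed
  have "b = (if a = 1 then n else a - 1)"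
  proof (cases "a = 1")
    case True
    have yn: "y n \<le> x a" if "n \<noteq> 1"
    proof -
      \<comment> \<open>With \<open>a = 1\<close> the range bound reads
        \<open>x n \<le> x a + l\<close>, so \<open>q = x a + l\<close> is admissible.\<close>
      have "GM_seq l n x l n \<le> x a + int l - int l"
        using True that r pa
        by (intro GM_seq_le[OF x l]) (auto simp: a_def[symmetric])
      then show ?thesis by (simp add: y_def)
    qed
    show ?thesis
    proof (cases "n = 1")
      case n1: True
      then show ?thesis using pb(1) True by simp
    next
      case False
      have bn: "y b \<le> y n" "y 1 \<le> y b" using narrow_mono[OF y] pb(1) by auto
      \<comment> \<open>As \<open>a = 1\<close>, the chain is
        \<open>x a - l < y 1 \<le> y b \<le> y n \<le> x a\<close>.\<close>
      then have "y b = x a"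
        using True ya yn[OF False] l pa(2) pb(2) by (intro sandwich) auto
      then have "y n = y b" using bn yn[OF False] by simp
      then show ?thesis using pb(1) pb(4)[of n] True by simp
    qed
  next
    case False
    then have a: "a - 1 \<in> {1..n}" "a \<in> {1..n}" using pa(1) by auto
    \<comment> \<open>Here \<open>q = x a\<close>, admissible by monotonicity.\<close>
    have prev: "y (a - 1) \<le> x a - int l"
      unfolding y_def using a pa narrow_mono[OF x, of "a - 1" a]
      by (intro GM_seq_le[OF x l]) (auto simp: a_def[symmetric])
    have first: "x a - 2 * int l < y 1"
      using narrow_first_gt[OF x l] GM_seq_ge[of x 1 l l n] by (simp add: y_def a_def)
    have "y 1 \<le> y (a - 1)" using narrow_mono[OF y] a by simp
    \<comment> \<open>Chain: \<open>y b < y 1 + l \<le> y (a - 1) + l \<le> x a\<close>.\<close>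
    then have upper: "y b < x a"
      using narrow_first_gt[OF y l] prev by (simp add: b_def)
    have "y 1 \<le> y b" using narrow_mono[OF y] pb(1) by simp
    \<comment> \<open>The only multiple of \<open>l\<close> strictly between
      \<open>x a - 2 * l\<close> and \<open>x a\<close>.\<close>
    then have yb: "y b = x a - int l"
      using first upper pa(2) pb(2) by (intro sandwich) auto
    have "b < a"
    proof (rule ccontr)
      assume "\<not> b < a"
      then have "y a \<le> y b" using narrow_mono[OF y, of a b] a pb(1) by simp
      then show False using ya yb by simp
    qed
    \<comment> \<open>Entry \<open>a - 1\<close> is squeezed onto the pivotal value, and the pivot
      is the last index carrying it.\<close>
    moreover have "y b \<le> y (a - 1)"
      using narrow_mono[OF y, of b "a - 1"] a pb(1) \<open>b < a\<close> by simp
    then have "a - 1 \<le> b" using prev yb pb(4)[OF a(1)] by simp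
    ultimately show ?thesis using False by simp
  qed
  then show ?thesis by (simp add: a_def b_def y_def)
qed

theorem lemma2:
  fixes n l :: nat and x0 :: "nat \<Rightarrow> int"
  assumes "n \<ge> 1" and "l \<ge> 2"
    and "nondecreasing n x0"
    and "has_multiple l n x0"
    and "vec_range n x0 \<le> int l"
  shows "\<forall>j. [int (pivot l n (GM_seq l n x0 j)) - int (pivot l n (GM_seq l n x0 (j + l))) = 1] (mod int n)
    \<and> pivot l n (GM_seq l n x0 (j + l)) =
        (if pivot l n (GM_seq l n x0 j) = 1 then n else pivot l n (GM_seq l n x0 j) - 1)"
proof
  fix j
  let ?x = "GM_seq l n x0 j"
  have x: "narrow l n ?x"
    using assms by (intro narrow_GM_seq) (auto simp: narrow_def)
  then have "pivot l n ?x \<ge> 1"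
    using pivot_min_multiple(1)[of l n ?x] by (simp add: narrow_def)
  moreover have period: "pivot l n (GM_seq l n x0 (j + l)) =
      (if pivot l n ?x = 1 then n else pivot l n ?x - 1)"
    using pivot_GM_seq_period[OF x] assms by (simp add: GM_seq_add)
  \<comment> \<open>If the earlier pivot is 1, the difference is \<open>1 - n\<close>.\<close>
  ultimately have
    "[int (pivot l n ?x) - int (pivot l n (GM_seq l n x0 (j + l))) = 1] (mod int n)"
    by (auto simp: cong_iff_dvd_diff of_nat_diff)
  then show "[int (pivot l n ?x) - int (pivot l n (GM_seq l n x0 (j + l))) = 1] (mod int n) \<and>
      pivot l n (GM_seq l n x0 (j + l)) = (if pivot l n ?x = 1 then n else pivot l n ?x - 1)"
    using period by blast
qed

end
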